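(* Let $d\ge1$ and, for each $n\geq 1$, let $\sigma_n$ be a uniformly random element of $G_n=\mathfrak{S}_n\wr(\mathbb{Z}/d\mathbb{Z})$ and let $\ell_n=(\ell_n^{(1)},\ldots,\ell_n^{(d)})$, where $\ell_n^{(i)}$ is the number of cycles of $\sigma_n$ with color $i\in\mathbb{Z}/d\mathbb{Z}$. Then the sequence of random vectors $(\ell_n)_{n\in\mathbb{N}}$ converges modulo the $d$-dimensional Poisson law with exponent $\phi(\xi)=\frac1d\sum_{i=1}^d(e^{i\xi_i}-1)$ (in $e^{i\xi_i}$ the $i$ in front of $\xi_i$ is the imaginary unit), with parameters $H_n=\sum_{j=1}^n\frac1j$ and limiting function $$\psi(\xi)=\prod_{n=1}^\infty\left(1+\frac{\phi(\xi)}{n}\right)e^{-\frac{\phi(\xi)}{n}}=e^{-\gamma\,\phi(\xi)}\,\frac{1}{\Gamma\!\left(\frac1d\sum_{i=1}^de^{i\xi_i}\right)}.$$ That is, $\mathbb{E}\big[e^{i\langle\xi,\ell_n\rangle}\big]=e^{H_n\phi(\xi)}\,\psi_n(\xi)$ with $\psi_n\to\psi$ uniformly on $(\mathbb{R}/2\pi\mathbb{Z})^d$ as $n\to\infty$.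
   Context: $G_n=\mathfrak{S}_n\ltimes(\mathbb{Z}/d\mathbb{Z})^n$ is the group of $d$-coloured permutations: pairs $\sigma=(\rho,k)$ with $\rho\in\mathfrak{S}_n$ a permutation of $\{1,\ldots,n\}$ and $k:\{1,\ldots,n\}\to\mathbb{Z}/d\mathbb{Z}$, with product $(\rho_1,k_1)(\rho_2,k_2)=(\rho_1\rho_2,\,k_1\circ\rho_2+k_2)$. The cycles of $\sigma=(\rho,k)$ are the cycles of $\rho$ (fixed points included), and the color of a cycle $c$ of $\rho$ is the element $\sum_{a\in c}k(a)\in\mathbb{Z}/d\mathbb{Z}$. The colors are labelled by $1,\dots,d$ modulo $d$. $\langle\xi,\ell\rangle=\sum_{j=1}^d\xi_j\ell^{(j)}$, $\gamma$ is the Euler--Mascheroni constant, and $1/\Gamma$ is the entire reciprocal Gamma function (equal to $0$ at non-positive integers). *)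

theory Defs
  imports
    "HOL-Probability.Probability"
    "HOL-Combinatorics.Orbits"
    "HOL-Algebra.Sym_Groups"
    "HOL-Algebra.Elementary_Groups"
begin

text \<open>
  Vectors indexed by the colours \<open>1, \<dots>, d\<close> are functions on \<open>nat\<close>, only the coordinates in
  \<open>{1..d}\<close> being relevant. Functions on the torus \<open>(\<real>/2\<pi>\<int>)\<^sup>d\<close> are represented by functions on
  \<open>\<real>\<^sup>d\<close> that are \<open>2\<pi>\<close>-periodic in each coordinate; for these, uniform convergence on the torus
  and on \<open>\<real>\<^sup>d\<close> are the same.
\<close>

definition real_vecs :: "nat \<Rightarrow> (nat \<Rightarrow> real) set" where
  "real_vecs d = {1..d} \<rightarrow>\<^sub>E UNIV"

definition pairing :: "nat \<Rightarrow> (nat \<Rightarrow> real) \<Rightarrow> (nat \<Rightarrow> int) \<Rightarrow> real" where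
  "pairing d \<xi> x = (\<Sum>j=1..d. \<xi> j * of_int (x j))"

definition char_fn ::
  "nat \<Rightarrow> 'a measure \<Rightarrow> ('a \<Rightarrow> nat \<Rightarrow> int) \<Rightarrow> (nat \<Rightarrow> real) \<Rightarrow> complex" where
  "char_fn d M X \<xi> = (LINT \<omega>|M. iexp (pairing d \<xi> (X \<omega>)))"

text \<open>
  The exponent of a law is the continuous logarithm of its characteristic function that
  vanishes at the origin; continuity and \<open>\<phi> 0 = 0\<close> remove the ambiguity modulo \<open>2\<pi>i\<close>.
\<close>

definition has_exponent ::
  "nat \<Rightarrow> (nat \<Rightarrow> int) pmf \<Rightarrow> ((nat \<Rightarrow> real) \<Rightarrow> complex) \<Rightarrow> bool" where
  "has_exponent d \<mu> \<phi> \<longleftrightarrow>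
     continuous_on (real_vecs d) \<phi> \<and> \<phi> (restrict (\<lambda>_. 0) {1..d}) = 0 \<and>
     (\<forall>\<xi>\<in>real_vecs d. char_fn d (measure_pmf \<mu>) (\<lambda>x. x) \<xi> = exp (\<phi> \<xi>))"

text \<open>
  Convergence modulo the law \<open>\<mu>\<close> with exponent \<open>\<phi>\<close>, parameters \<open>\<Lambda> n\<close> and limiting function
  \<open>\<psi>\<close>, of random vectors \<open>X n\<close>, \<open>n \<ge> 1\<close>, each defined on its own probability space \<open>M n\<close>.
\<close>

definition converges_mod ::
  "nat \<Rightarrow> (nat \<Rightarrow> 'a measure) \<Rightarrow> (nat \<Rightarrow> 'a \<Rightarrow> nat \<Rightarrow> int) \<Rightarrow> (nat \<Rightarrow> int) pmf \<Rightarrow>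
   ((nat \<Rightarrow> real) \<Rightarrow> complex) \<Rightarrow> (nat \<Rightarrow> real) \<Rightarrow> ((nat \<Rightarrow> real) \<Rightarrow> complex) \<Rightarrow> bool" where
  "converges_mod d M X \<mu> \<phi> \<Lambda> \<psi> \<longleftrightarrow>
     has_exponent d \<mu> \<phi> \<and>
     filterlim \<Lambda> at_top sequentially \<and>
     (\<exists>\<psi>'. (\<forall>n\<ge>1. \<forall>\<xi>\<in>real_vecs d.
              char_fn d (M n) (X n) \<xi> = exp (of_real (\<Lambda> n) * \<phi> \<xi>) * \<psi>' n \<xi>) \<and>
           uniform_limit (real_vecs d) \<psi>' \<psi> sequentially)"

text \<open>The law of \<open>d\<close> independent Poisson variables with parameter \<open>1/d\<close>.\<close>

definition poisson_vec_pmf :: "nat \<Rightarrow> (nat \<Rightarrow> int) pmf" where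
  "poisson_vec_pmf d = Pi_pmf {1..d} 0 (\<lambda>_. map_pmf int (poisson_pmf (1 / real d)))"

definition poisson_exponent :: "nat \<Rightarrow> (nat \<Rightarrow> real) \<Rightarrow> complex" where
  "poisson_exponent d \<xi> = (1 / of_nat d) * (\<Sum>i=1..d. (iexp (\<xi> i) - 1))"

definition limiting_factor :: "nat \<Rightarrow> (nat \<Rightarrow> real) \<Rightarrow> nat \<Rightarrow> complex" where
  "limiting_factor d \<xi> n =
     (1 + poisson_exponent d \<xi> / of_nat n) * exp (- (poisson_exponent d \<xi> / of_nat n))"

text \<open>Library products start at index \<open>0\<close>, hence the shift.\<close>

definition limiting_function :: "nat \<Rightarrow> (nat \<Rightarrow> real) \<Rightarrow> complex" where
  "limiting_function d \<xi> = (\<Prod>m. limiting_factor d \<xi> (Suc m))"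

definition coloured_perm_group :: "nat \<Rightarrow> nat \<Rightarrow> ((nat \<Rightarrow> nat) \<times> (nat \<Rightarrow> int)) monoid" where
  "coloured_perm_group d n =
     \<lparr> carrier = carrier (sym_group n) \<times> ({1..n} \<rightarrow>\<^sub>E carrier (integer_mod_group d)),
       mult = (\<lambda>(\<rho>\<^sub>1, k\<^sub>1) (\<rho>\<^sub>2, k\<^sub>2).
          (\<rho>\<^sub>1 \<circ> \<rho>\<^sub>2, \<lambda>a\<in>{1..n}. k\<^sub>1 (\<rho>\<^sub>2 a) \<otimes>\<^bsub>integer_mod_group d\<^esub> k\<^sub>2 a)),
       one = (id, \<lambda>a\<in>{1..n}. \<one>\<^bsub>integer_mod_group d\<^esub>) \<rparr>"

lemma group_coloured_perm_group: "group (coloured_perm_group d n)"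
proof (rule groupI)
  interpret Z: comm_group "integer_mod_group d" by simp
  note defs = coloured_perm_group_def sym_group_def
  note dels [simp del] =
    atLeastAtMost_iff One_nat_def mult_integer_mod_group one_integer_mod_group inv_integer_mod_group
  have mem: "k a \<in> carrier (integer_mod_group d)"
    if "k \<in> {1..n} \<rightarrow>\<^sub>E carrier (integer_mod_group d)" "a \<in> {1..n}" for k :: "nat \<Rightarrow> int" and a
    using that by (rule PiE_mem)
  have arb: "k a = undefined"
    if "k \<in> {1..n} \<rightarrow>\<^sub>E carrier (integer_mod_group d)" "a \<notin> {1..n}" for k :: "nat \<Rightarrow> int" and a
    using that by (rule PiE_arb)
  let ?G = "coloured_perm_group d n"
  show "\<one>\<^bsub>?G\<^esub> \<in> carrier ?G"
    by (auto simp: defs permutes_id)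
  fix x y assume xy: "x \<in> carrier ?G" "y \<in> carrier ?G"
  then show "x \<otimes>\<^bsub>?G\<^esub> y \<in> carrier ?G"
    by (auto simp: defs permutes_compose permutes_in_image mem intro!: Z.m_closed)
  show "\<one>\<^bsub>?G\<^esub> \<otimes>\<^bsub>?G\<^esub> x = x"
    using xy by (auto simp: defs permutes_in_image mem fun_eq_iff arb)
  show "\<exists>y\<in>carrier ?G. y \<otimes>\<^bsub>?G\<^esub> x = \<one>\<^bsub>?G\<^esub>"
  proof (cases x)
    case (Pair p k)
    have p: "p permutes {1..n}" and k: "k \<in> {1..n} \<rightarrow>\<^sub>E carrier (integer_mod_group d)"
      using xy Pair by (auto simp: defs)
    let ?y = "(inv_into UNIV p, \<lambda>a\<in>{1..n}. inv\<^bsub>integer_mod_group d\<^esub> k (inv_into UNIV p a))"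
    have "?y \<in> carrier ?G"
      using p k permutes_inv[OF p]
      by (auto simp: defs permutes_in_image mem intro!: Z.inv_closed)
    moreover have "?y \<otimes>\<^bsub>?G\<^esub> x = \<one>\<^bsub>?G\<^esub>"
      using p k Pair
      by (auto simp: defs permutes_in_image permutes_inverses permutes_inv_o mem fun_eq_iff)
    ultimately show ?thesis by blast
  qed
  fix z assume z: "z \<in> carrier ?G"
  show "x \<otimes>\<^bsub>?G\<^esub> y \<otimes>\<^bsub>?G\<^esub> z = x \<otimes>\<^bsub>?G\<^esub> (y \<otimes>\<^bsub>?G\<^esub> z)"
    using xy z by (auto simp: defs permutes_in_image mem fun_eq_iff Z.m_assoc)
qed

text \<open>A cycle is identified with its support; fixed points give singletons.\<close>

definition perm_cycles :: "nat \<Rightarrow> (nat \<Rightarrow> nat) \<Rightarrow> nat set set" where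
  "perm_cycles n \<rho> = orbit \<rho> ` {1..n}"

definition cycle_colour :: "nat \<Rightarrow> (nat \<Rightarrow> int) \<Rightarrow> nat set \<Rightarrow> int" where
  "cycle_colour d k c = (\<Sum>a\<in>c. k a) mod int d"

text \<open>
  The label \<open>i \<in> {1..d}\<close> stands for the class of \<open>i\<close> modulo \<open>d\<close>, so the label \<open>d\<close> is the colour \<open>0\<close>.
\<close>

definition cycle_counts ::
  "nat \<Rightarrow> nat \<Rightarrow> (nat \<Rightarrow> nat) \<times> (nat \<Rightarrow> int) \<Rightarrow> nat \<Rightarrow> int" where
  "cycle_counts d n \<sigma> i =
     int (card {c \<in> perm_cycles n (fst \<sigma>). cycle_colour d (snd \<sigma>) c = int i mod int d})"

end

theory Submission
  imports Defs "HOL-Complex_Analysis.Weierstrass_Factorization"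
begin

text \<open>
  For a fixed permutation the colours of its cycles are independent and uniform, so averaging
  \<open>exp (i\<langle>\<xi>, \<ell>\<rangle>)\<close> over the colourings gives \<open>\<theta>\<close> raised to the number of cycles, where
  \<open>\<theta> = 1 + \<phi>(\<xi>)\<close> is the mean of the \<open>exp (i \<xi>\<^sub>j)\<close>. Building permutations one point at a time, a new
  point either opens a cycle or is spliced into one of the existing cycles, hence the mean over
  permutations is \<open>\<theta>(\<theta> + 1)\<dots>(\<theta> + n - 1)/n! = \<Prod>(1 + \<phi>/j)\<close>. Dividing by \<open>exp (H\<^sub>n \<phi>)\<close> leaves the
  partial products of the Weierstrass product of \<open>1/\<Gamma>\<close>, which converge uniformly for bounded \<open>\<phi>\<close>.
\<close>

section \<open>Permutations counted by their number of cycles\<close>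

text \<open>\<open>transpose a b \<circ> q\<close> is \<open>q\<close> with the new point \<open>a\<close> spliced into the cycle of \<open>b\<close>, just before \<open>b\<close>.\<close>

lemma orbit_transpose_comp:
  assumes q: "q permutes S" and "finite S" "a \<notin> S" "b \<in> S" "x \<in> S"
  shows "orbit (Transposition.transpose a b \<circ> q) x =
           (if b \<in> orbit q x then insert a (orbit q x) else orbit q x)"
    and "orbit (Transposition.transpose a b \<circ> q) a = orbit (Transposition.transpose a b \<circ> q) b"
proof -
  define p where "p = Transposition.transpose a b \<circ> q"
  have qa: "q a = a" and qS: "y \<in> S \<Longrightarrow> q y \<in> S" for y
    using assms by (auto simp: permutes_not_in permutes_in_image)
  have pa: "p a = b" and pb: "y \<in> S \<Longrightarrow> p y = (if q y = b then a else q y)" for y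
    using qS[of y] assms qa by (auto simp: p_def Transposition.transpose_def)
  have "p permutes insert a S"
    unfolding p_def using assms by (intro permutes_compose permutes_swap_id) (auto intro: permutes_subset)
  then have perm: "permutation p"
    using \<open>finite S\<close> by (auto simp: permutation_permutes)
  show orbit_a: "orbit (Transposition.transpose a b \<circ> q) a = orbit (Transposition.transpose a b \<circ> q) b"
    using permutation_orbit_step[OF perm, of a] pa unfolding p_def by simp
  have sub: "orbit q x \<subseteq> S"
    using q \<open>x \<in> S\<close> by (rule permutes_orbit_subset)
  \<comment> \<open>A step of \<open>q\<close> is one step of \<open>p\<close>, or two steps through
    \<open>a\<close> when it leads to \<open>b\<close>.\<close>
  have 1: "y \<in> orbit p x" if "y \<in> orbit q x" for y
    using that
  proof induction
    case base
    then show ?case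
      using pb[OF \<open>x \<in> S\<close>] pa by (metis orbit.base orbit.step)
  next
    case (step y)
    then show ?case
      using pb[of y] pa sub by (metis orbit.step subsetD)
  qed
  have 2: "a \<in> orbit p x" if "b \<in> orbit p x"
    using that permutation_self_in_orbit[OF perm, of a] orbit_a unfolding p_def
    by (metis orbit_trans)
  \<comment> \<open>The set contains \<open>p x\<close> and is closed under \<open>p\<close>:
    \<open>a\<close> goes to \<open>b\<close>, and a point of \<open>S\<close> goes to
    \<open>a\<close> only if \<open>q\<close> sends it to \<open>b\<close>.\<close>
  have 3: "y \<in> (if b \<in> orbit q x then insert a (orbit q x) else orbit q x)"
    if "y \<in> orbit p x" for y
    using that
  proof induction
    case base
    then show ?case
      using pb[OF \<open>x \<in> S\<close>] orbit.base[of q x] by auto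
  next
    case (step y)
    show ?case
    proof (cases "y = a")
      case True
      then show ?thesis using step sub \<open>a \<notin> S\<close> pa by (auto split: if_splits)
    next
      case False
      then have "y \<in> orbit q x" using step by (auto split: if_splits)
      moreover from this have "y \<in> S" using sub by auto
      ultimately show ?thesis using pb[of y] orbit.step[of y q x] by auto
    qed
  qed
  show "orbit (Transposition.transpose a b \<circ> q) x =
      (if b \<in> orbit q x then insert a (orbit q x) else orbit q x)"
    unfolding p_def[symmetric]
  proof (rule Set.set_eqI)
    fix y
    show "y \<in> orbit p x \<longleftrightarrow> y \<in> (if b \<in> orbit q x then insert a (orbit q x) else orbit q x)"
      using 1[of y] 1[of b] 2 3[of y] by (cases "b \<in> orbit q x") auto
  qed
qed

text \<open>The orbit of \<open>a\<close> coincides with that of \<open>b\<close>, so the new point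
  adds no orbit; splicing is injective on the old orbits because deleting \<open>a\<close> undoes
  it.\<close>

lemma card_orbits_transpose_comp:
  assumes q: "q permutes S" and "finite S" "a \<notin> S" "b \<in> S"
  shows "card (orbit (Transposition.transpose a b \<circ> q) ` insert a S) = card (orbit q ` S)"
proof -
  define h where "h c = (if b \<in> c then insert a c else c)" for c
  have "orbit (Transposition.transpose a b \<circ> q) ` insert a S = h ` orbit q ` S"
  proof -
    have "orbit (Transposition.transpose a b \<circ> q) ` insert a S = orbit (Transposition.transpose a b \<circ> q) ` S"
      using orbit_transpose_comp(2)[OF q assms(2-4,4)] \<open>b \<in> S\<close> by auto
    then show ?thesis
      using orbit_transpose_comp(1)[OF q assms(2-4)] by (auto simp: h_def image_image intro!: image_cong)
  qed
  moreover have "inj_on h (orbit q ` S)"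
  proof (rule inj_on_inverseI)
    fix c assume "c \<in> orbit q ` S"
    then have "a \<notin> c" using permutes_orbit_subset[OF q] \<open>a \<notin> S\<close> by auto
    then show "h c - {a} = c" by (auto simp: h_def)
  qed
  ultimately show ?thesis by (simp add: card_image)
qed

lemma card_orbits_insert_fixpoint:
  assumes q: "q permutes S" and "finite S" "a \<notin> S"
  shows "card (orbit q ` insert a S) = Suc (card (orbit q ` S))"
proof -
  have "orbit q a = {a}"
    using permutes_not_in[OF q \<open>a \<notin> S\<close>] by (simp add: orbit_eq_singleton_iff)
  moreover have "{a} \<notin> orbit q ` S"
    using permutes_orbit_subset[OF q] \<open>a \<notin> S\<close> by blast
  ultimately show ?thesis using \<open>finite S\<close> by simp
qed

text \<open>Each permutation of \<open>insert a S\<close> is \<open>transpose a b \<circ> q\<close>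
  for exactly one \<open>b\<close> in \<open>insert a S\<close> and one \<open>q\<close> permuting
  \<open>S\<close>. The choice \<open>b = a\<close> opens a cycle and contributes \<open>z\<close>;
  each of the \<open>card S\<close> others leaves the number of cycles unchanged and contributes 1.
  Together they give the next factor of the rising factorial.\<close>

lemma sum_power_card_orbits:
  fixes z :: "'a :: comm_ring_1"
  assumes "finite S"
  shows "(\<Sum>p | p permutes S. z ^ card (orbit p ` S)) = pochhammer z (card S)"
  using assms
proof induction
  case empty
  then show ?case by simp
next
  case (insert a S)
  have "(\<Sum>q | q permutes S. z ^ card (orbit (Transposition.transpose a b \<circ> q) ` insert a S)) =
      (if b = a then z else 1) * pochhammer z (card S)" if "b \<in> insert a S" for b
  proof (cases "b = a")
    case True
    then show ?thesis
      using insert by (simp add: card_orbits_insert_fixpoint sum_distrib_left[symmetric] del: image_insert)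
  next
    case False
    then show ?thesis
      using insert that by (simp add: card_orbits_transpose_comp del: image_insert)
  qed
  then have "(\<Sum>p | p permutes insert a S. z ^ card (orbit p ` insert a S)) =
      (\<Sum>b\<in>insert a S. (if b = a then z else 1) * pochhammer z (card S))"
    by (simp only: sum_over_permutations_insert[OF insert(1,2)] cong: sum.cong)
  also have "\<dots> = (z + of_nat (card S)) * pochhammer z (card S)"
  proof -
    have "(\<Sum>b\<in>S. (if b = a then z else 1) * pochhammer z (card S)) =
        (\<Sum>b\<in>S. pochhammer z (card S))"
      using insert by (intro sum.cong) auto
    then show ?thesis using insert by (simp add: algebra_simps)
  qed
  finally show ?case using insert by (simp add: pochhammer_Suc mult.commute)
qed

section \<open>The Weierstrass product for the reciprocal Gamma function\<close>

definition gamma_factor :: "nat \<Rightarrow> complex \<Rightarrow> complex" where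
  "gamma_factor m z = (1 + z / of_nat (Suc m)) * exp (- (z / of_nat (Suc m)))"

text \<open>Makes the standard estimate for the elementary factor available:
  \<open>|E_1(w) - 1| \<le> 3 |w|^2\<close> for \<open>|w| \<le> 1/2\<close>.\<close>

lemma gamma_factor_weierstrass: "gamma_factor m z = weierstrass_factor 1 (- (z / of_nat (Suc m)))"
  by (simp add: gamma_factor_def weierstrass_factor_def)

text \<open>With \<open>r\<close> in place of \<open>norm z\<close> the bound is uniform on a disc
  and summable in \<open>m\<close>; \<open>2 * r \<le> real (Suc m)\<close> keeps the argument of
  the elementary factor within radius 1/2.\<close>

lemma norm_gamma_factor_le:
  assumes "norm z \<le> r" "2 * r \<le> real (Suc m)"
  shows "norm (gamma_factor m z - 1) \<le> 3 * r\<^sup>2 * inverse (real (Suc m) ^ 2)"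
proof -
  have le: "norm (- (z / of_nat (Suc m))) \<le> r / real (Suc m)"
    using assms by (simp add: norm_divide divide_right_mono del: of_nat_Suc)
  also have "\<dots> \<le> 1 / 2"
    using assms by (simp add: field_simps)
  finally have "norm (gamma_factor m z - 1) \<le> 3 * norm (- (z / of_nat (Suc m))) ^ Suc 1"
    unfolding gamma_factor_weierstrass by (rule weierstrass_factor_bound)
  also have "\<dots> \<le> 3 * (r / real (Suc m)) ^ Suc 1"
    using le by (intro mult_left_mono power_mono) auto
  finally show ?thesis by (simp add: power2_eq_square field_simps)
qed

lemma summable_inverse_Suc_squared: "summable (\<lambda>m. c * inverse (real (Suc m) ^ 2))"
proof -
  have "summable (\<lambda>m. inverse (real m ^ 2))"
    using inverse_power_summable[of 2, where ?'a = real] by simp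
  then have "summable (\<lambda>m. inverse (real (Suc m) ^ 2))"
    by (rule summable_ignore_initial_segment[where k = 1, simplified])
  then show ?thesis by (rule summable_mult)
qed

lemma convergent_prod_gamma_factor: "convergent_prod (\<lambda>m. gamma_factor m z)"
proof -
  have "summable (\<lambda>m. norm (gamma_factor m z - 1))"
  proof (rule summable_comparison_test_ev)
    show "\<forall>\<^sub>F m in sequentially. norm (norm (gamma_factor m z - 1)) \<le>
        3 * (norm z)\<^sup>2 * inverse (real (Suc m) ^ 2)"
      using eventually_ge_at_top[of "nat \<lceil>2 * norm z\<rceil>"]
    proof eventually_elim
      case (elim m)
      then have "2 * norm z \<le> real (Suc m)" by linarith
      then show ?case using norm_gamma_factor_le[of z "norm z" m] by simp
    qed
  qed (rule summable_inverse_Suc_squared)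
  then show ?thesis
    by (intro abs_convergent_prod_imp_convergent_prod) (simp add: abs_convergent_prod_conv_summable)
qed

lemma uniform_limit_gamma_factor:
  "uniform_limit (cball 0 r) (\<lambda>n z. \<Prod>m<n. gamma_factor m z) (\<lambda>z. \<Prod>m. gamma_factor m z) sequentially"
proof -
  have "uniformly_convergent_on (cball 0 r) (\<lambda>n z. \<Sum>m<n. norm (gamma_factor m z - 1))"
  proof (rule Weierstrass_m_test'_ev)
    show "\<forall>\<^sub>F m in sequentially. \<forall>z\<in>cball 0 r. norm (norm (gamma_factor m z - 1)) \<le>
        3 * r\<^sup>2 * inverse (real (Suc m) ^ 2)"
      using eventually_ge_at_top[of "nat \<lceil>2 * r\<rceil>"]
    proof eventually_elim
      case (elim m)
      then have "2 * r \<le> real (Suc m)" by linarith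
      then show ?case using norm_gamma_factor_le by simp
    qed
  qed (rule summable_inverse_Suc_squared)
  \<comment> \<open>The factors are continuous and the disc is compact, so uniform convergence of
    the sums of \<open>norm (gamma_factor m z - 1)\<close> carries over to the products.\<close>
  then have "uniformly_convergent_on (cball 0 r) (\<lambda>n z. \<Prod>m<n. gamma_factor m z)"
    unfolding gamma_factor_def
    by (intro uniformly_convergent_on_prod' continuous_intros) (auto simp del: of_nat_Suc)
  then have "uniform_limit (cball 0 r) (\<lambda>n z. \<Prod>m<n. gamma_factor m z)
      (\<lambda>z. lim (\<lambda>n. \<Prod>m<n. gamma_factor m z)) sequentially"
    by (simp add: uniformly_convergent_uniform_limit_iff)
  moreover have "(\<Prod>m. gamma_factor m z) = lim (\<lambda>n. \<Prod>m<n. gamma_factor m z)" for z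
    \<comment> \<open>\<open>convergent_prod_LIMSEQ\<close> includes the factor of index
      \<open>n\<close>; omitting it does not change the limit.\<close>
    using convergent_prod_LIMSEQ[OF convergent_prod_gamma_factor[of z]]
    by (metis LIMSEQ_lessThan_iff_atMost limI)
  ultimately show ?thesis by simp
qed

text \<open>Weierstrass's formula for \<open>rGamma z\<close> carries an extra factor
  \<open>z\<close>, as does \<open>rGamma z = z * rGamma (1 + z)\<close>. Cancelling it requires
  \<open>z \<noteq> 0\<close>; at 0 every factor is 1.\<close>

lemma prodinf_gamma_factor:
  "(\<Prod>m. gamma_factor m z) = exp (- euler_mascheroni * z) * rGamma (1 + z)"
proof (cases "z = 0")
  case True
  then show ?thesis by (simp add: gamma_factor_def)
next
  case False
  have "(\<lambda>n. \<Prod>m<n. gamma_factor m z) \<longlonglongrightarrow> (\<Prod>m. gamma_factor m z)"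
    using convergent_prod_LIMSEQ[OF convergent_prod_gamma_factor[of z]]
    by (simp add: LIMSEQ_lessThan_iff_atMost)
  then have "(\<lambda>n. exp (euler_mascheroni * z) * z * (\<Prod>m<n. gamma_factor m z)) \<longlonglongrightarrow>
      exp (euler_mascheroni * z) * z * (\<Prod>m. gamma_factor m z)"
    by (intro tendsto_intros)
  moreover have "exp (euler_mascheroni * z) * z * (\<Prod>m<n. gamma_factor m z) =
      rGamma_series_Weierstrass z n" for n
    unfolding rGamma_series_Weierstrass_def gamma_factor_def
    by (simp add: prod.atLeast1_atMost_eq)
  ultimately have "exp (euler_mascheroni * z) * z * (\<Prod>m. gamma_factor m z) = rGamma z"
    using rGamma_Weierstrass_complex[of z] LIMSEQ_unique by auto
  also have "rGamma z = z * rGamma (1 + z)"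
    using rGamma_plus1[of z] by (simp add: add.commute)
  finally have "z * (\<Prod>m. gamma_factor m z) = z * (exp (- euler_mascheroni * z) * rGamma (1 + z))"
    by (simp add: exp_minus field_simps)
  then show ?thesis using False by simp
qed

text \<open>Each linear factor \<open>1 + z/j\<close> is a gamma factor times
  \<open>exp (z/j)\<close>, and these exponentials collect to \<open>exp (harm n * z)\<close>. This
  splits off the Poisson part with parameter \<open>harm n\<close>.\<close>

lemma pochhammer_eq_harm_gamma_factor:
  "pochhammer (1 + z) n / fact n = exp (of_real (harm n) * z) * (\<Prod>m<n. gamma_factor m z)"
proof (induction n)
  case 0
  then show ?case by (simp add: harm_def)
next
  case (Suc n)
  have "exp (of_real (harm n) * z) = exp (of_real (harm (Suc n)) * z) * exp (- (z / of_nat (Suc n)))"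
    by (simp add: harm_Suc algebra_simps divide_inverse flip: exp_add)
  then have "exp (of_real (harm n) * z) * (\<Prod>m<n. gamma_factor m z) * (1 + z / of_nat (Suc n)) =
      exp (of_real (harm (Suc n)) * z) * (\<Prod>m<Suc n. gamma_factor m z)"
    unfolding prod.lessThan_Suc gamma_factor_def[of n] by (simp only: mult_ac)
  moreover have "pochhammer (1 + z) (Suc n) / fact (Suc n) =
      pochhammer (1 + z) n / fact n * (1 + z / of_nat (Suc n))"
    by (simp add: pochhammer_Suc divide_simps del: of_nat_Suc) (simp add: algebra_simps)
  ultimately show ?case by (simp only: Suc.IH)
qed

section \<open>The Poisson law and its exponent\<close>

lemma expectation_iexp_poisson:
  assumes "0 < r"
  shows "measure_pmf.expectation (poisson_pmf r) (\<lambda>n. iexp (t * real n)) = exp (of_real r * (iexp t - 1))"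
proof -
  \<comment> \<open>The terms of the expectation, written as those of an exponential series times
    the constant \<open>exp (- r)\<close>.\<close>
  let ?f = "\<lambda>n. (of_real r * iexp t) ^ n /\<^sub>R fact n * of_real (exp (- r))"
  have f: "pmf (poisson_pmf r) n *\<^sub>R iexp (t * real n) = ?f n" for n
    using assms by (simp add: scaleR_conv_of_real power_mult_distrib divide_inverse mult_ac flip: exp_of_nat_mult)
  have "summable (\<lambda>n. norm (?f n))"
    unfolding norm_mult by (intro summable_mult2 summable_norm_exp)
  then have "(\<integral>n. ?f n \<partial>count_space UNIV) = (\<Sum>n. ?f n)"
    by (intro integral_count_space_nat) (simp add: integrable_count_space_nat_iff)
  also have "\<dots> = exp (of_real r * iexp t) * of_real (exp (- r))"
    using summable_exp_generic[of "of_real r * iexp t"] by (subst suminf_mult2[symmetric]) (simp_all add: exp_def)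
  also have "\<dots> = exp (of_real r * (iexp t - 1))"
    by (simp add: right_diff_distrib exp_diff exp_minus divide_inverse flip: exp_of_real)
  finally show ?thesis
    unfolding measure_pmf_eq_density by (subst integral_density) (simp_all only: f, simp_all)
qed

text \<open>The coordinates are independent under the product law, so the characteristic function
  factors into one-dimensional Poisson ones with parameter \<open>1/d\<close>, whose exponents add
  up.\<close>

lemma char_fn_poisson_vec_pmf:
  assumes "d \<ge> 1"
  shows "char_fn d (measure_pmf (poisson_vec_pmf d)) (\<lambda>x. x) \<xi> = exp (poisson_exponent d \<xi>)"
proof -
  let ?p = "map_pmf int (poisson_pmf (1 / real d))"
  have "prob_space.indep_vars (measure_pmf (poisson_vec_pmf d)) (\<lambda>_. borel) (\<lambda>j x. iexp (\<xi> j * of_int (x j))) {1..d}"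
  proof (rule prob_space.indep_vars_compose2[OF measure_pmf.prob_space_axioms,
        where X = "\<lambda>j x. x j" and Y = "\<lambda>j m. iexp (\<xi> j * of_int m)" and M' = "\<lambda>_. count_space UNIV"])
    show "prob_space.indep_vars (measure_pmf (poisson_vec_pmf d)) (\<lambda>_. count_space UNIV) (\<lambda>j x. x j) {1..d}"
      unfolding poisson_vec_pmf_def by (rule indep_vars_Pi_pmf) simp
  qed simp
  then have "char_fn d (measure_pmf (poisson_vec_pmf d)) (\<lambda>x. x) \<xi> =
      (\<Prod>j=1..d. measure_pmf.expectation (poisson_vec_pmf d) (\<lambda>x. iexp (\<xi> j * of_int (x j))))"
    unfolding char_fn_def pairing_def
    by (simp add: sum_distrib_left exp_sum)
      (subst prob_space.indep_vars_lebesgue_integral[OF measure_pmf.prob_space_axioms],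
        auto intro!: measure_pmf.integrable_const_bound[where B = 1])
  also have "\<dots> = (\<Prod>j=1..d. measure_pmf.expectation
      (map_pmf (\<lambda>x. x j) (poisson_vec_pmf d)) (\<lambda>m. iexp (\<xi> j * of_int m)))"
    by simp
  also have "\<dots> = (\<Prod>j=1..d. measure_pmf.expectation ?p (\<lambda>m. iexp (\<xi> j * of_int m)))"
    unfolding poisson_vec_pmf_def by (intro prod.cong refl) (simp add: Pi_pmf_component del: integral_map_pmf)
  also have "\<dots> = (\<Prod>j=1..d. exp (of_real (1 / real d) * (iexp (\<xi> j) - 1)))"
    using assms expectation_iexp_poisson[of "1 / real d"] by simp
  also have "\<dots> = exp (poisson_exponent d \<xi>)"
    unfolding poisson_exponent_def by (simp add: exp_sum sum_distrib_left)
  finally show ?thesis .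
qed

lemma continuous_on_poisson_exponent: "continuous_on A (poisson_exponent d)"
proof -
  have "continuous_on A (\<lambda>\<xi>. \<xi> i)" for i :: nat and A :: "(nat \<Rightarrow> real) set"
    by (rule continuous_on_product_coordinates[THEN continuous_on_subset]) simp
  then show ?thesis
    unfolding poisson_exponent_def by (intro continuous_intros)
qed

text \<open>Confines the exponent to one disc for all \<xi>, so that uniform convergence of the
  product on that disc becomes convergence uniform in \<xi>.\<close>

lemma norm_poisson_exponent_le:
  assumes "d \<ge> 1"
  shows "norm (poisson_exponent d \<xi>) \<le> 2"
proof -
  have "norm (iexp t - 1) \<le> 2" for t
    using norm_triangle_ineq4[of "iexp t" 1] by simp
  then have "norm (\<Sum>i=1..d. (iexp (\<xi> i) - 1)) \<le> of_nat (card {1..d}) * 2"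
    by (intro sum_norm_bound)
  then show ?thesis
    using assms by (simp add: poisson_exponent_def norm_mult norm_divide field_simps)
qed

text \<open>This mean of the \<open>iexp (\<xi> i)\<close> is both the base of the rising factorial
  and the argument of \<open>rGamma\<close>.\<close>

lemma poisson_exponent_plus_1:
  assumes "d \<ge> 1"
  shows "1 + poisson_exponent d \<xi> = (1 / of_nat d) * (\<Sum>i=1..d. iexp (\<xi> i))"
  using assms by (simp add: poisson_exponent_def sum_subtractf field_simps)

section \<open>Averaging over colourings\<close>

lemma sum_PiE_insert:
  fixes F :: "('a \<Rightarrow> 'b) \<Rightarrow> 'c :: comm_monoid_add"
  assumes "x \<notin> S"
  shows "(\<Sum>k\<in>insert x S \<rightarrow>\<^sub>E Z. F k) = (\<Sum>y\<in>Z. \<Sum>k\<in>S \<rightarrow>\<^sub>E Z. F (k(x := y)))"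
proof -
  have "(\<Sum>k\<in>insert x S \<rightarrow>\<^sub>E Z. F k) = (\<Sum>(y, k)\<in>Z \<times> (S \<rightarrow>\<^sub>E Z). F (k(x := y)))"
    unfolding PiE_insert_eq using inj_combinator[OF assms, of "\<lambda>_. Z"]
    by (subst sum.reindex) (auto simp: case_prod_unfold o_def)
  then show ?thesis by (simp add: sum.cartesian_product)
qed

lemma sum_PiE_Un_disjoint:
  fixes F :: "('a \<Rightarrow> 'b) \<Rightarrow> 'c :: comm_monoid_add"
  assumes "S \<inter> T = {}"
  shows "(\<Sum>k\<in>S \<union> T \<rightarrow>\<^sub>E Z. F k) = (\<Sum>g\<in>S \<rightarrow>\<^sub>E Z. \<Sum>h\<in>T \<rightarrow>\<^sub>E Z. F (\<lambda>a. if a \<in> S then g a else h a))"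
proof -
  have "(\<Sum>k\<in>S \<union> T \<rightarrow>\<^sub>E Z. F k) =
      (\<Sum>(g, h)\<in>(S \<rightarrow>\<^sub>E Z) \<times> (T \<rightarrow>\<^sub>E Z). F (\<lambda>a. if a \<in> S then g a else h a))"
    using assms
    by (intro sum.reindex_bij_witness[where i = "\<lambda>(g, h) a. if a \<in> S then g a else h a"
          and j = "\<lambda>k. (restrict k S, restrict k T)"])
      (auto simp: fun_eq_iff PiE_iff extensional_def restrict_def split: if_splits
        intro!: arg_cong[where f = F])
  then show ?thesis by (simp add: sum.cartesian_product)
qed

lemma sum_shift_mod:
  fixes w :: "int \<Rightarrow> 'a :: comm_monoid_add" and d :: nat
  assumes "d \<ge> 1"
  shows "(\<Sum>r\<in>{0..<int d}. w ((r + s) mod int d)) = (\<Sum>r\<in>{0..<int d}. w r)"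
  using assms
  by (intro sum.reindex_bij_witness[where i = "\<lambda>r. (r - s) mod int d" and j = "\<lambda>r. (r + s) mod int d"])
    (auto simp: mod_simps)

text \<open>With the colours of all points but one fixed, the total colour runs once through every
  residue as the remaining colour varies. Hence the colour of a block is uniformly
  distributed.\<close>

lemma sum_colourings_block:
  fixes w :: "int \<Rightarrow> 'a :: field_char_0" and d :: nat
  assumes "finite c" "c \<noteq> {}" "d \<ge> 1"
  shows "(\<Sum>k\<in>c \<rightarrow>\<^sub>E {0..<int d}. w ((\<Sum>a\<in>c. k a) mod int d)) =
    of_nat d ^ card c * ((\<Sum>r\<in>{0..<int d}. w r) / of_nat d)"
proof -
  obtain x S where c: "c = insert x S" "x \<notin> S"
    using \<open>c \<noteq> {}\<close> by (metis ex_in_conv mk_disjoint_insert)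
  have "(\<Sum>a\<in>c. (k(x := y)) a) = y + (\<Sum>a\<in>S. k a)" for y and k :: "_ \<Rightarrow> int"
  proof -
    have "(\<Sum>a\<in>S. (k(x := y)) a) = (\<Sum>a\<in>S. k a)"
      using c(2) by (intro sum.cong) auto
    then show ?thesis using c \<open>finite c\<close> by simp
  qed
  then have "(\<Sum>k\<in>c \<rightarrow>\<^sub>E {0..<int d}. w ((\<Sum>a\<in>c. k a) mod int d)) =
      (\<Sum>y\<in>{0..<int d}. \<Sum>k\<in>S \<rightarrow>\<^sub>E {0..<int d}. w ((y + (\<Sum>a\<in>S. k a)) mod int d))"
    using sum_PiE_insert[OF c(2), of "\<lambda>k. w ((\<Sum>a\<in>c. k a) mod int d)"] c(1) by simp
  also have "\<dots> = (\<Sum>k\<in>S \<rightarrow>\<^sub>E {0..<int d}. \<Sum>r\<in>{0..<int d}. w r)"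
    using assms by (subst sum.swap) (simp only: sum_shift_mod)
  \<comment> \<open>\<open>S\<close> has one point fewer than \<open>c\<close>, hence the division
    by \<open>d\<close>.\<close>
  also have "\<dots> = of_nat d ^ card c * ((\<Sum>r\<in>{0..<int d}. w r) / of_nat d)"
    using c assms by (simp add: card_PiE)
  finally show ?thesis .
qed

text \<open>Disjoint blocks are coloured independently, so splitting off one block factors the sum,
  and \<open>sum_colourings_block\<close> evaluates the factor of that block.\<close>

lemma sum_colourings_blocks:
  fixes w :: "int \<Rightarrow> 'a :: field_char_0" and d :: nat
  assumes "finite C" "disjoint C" "\<And>c. c \<in> C \<Longrightarrow> finite c \<and> c \<noteq> {}" "d \<ge> 1"
  shows "(\<Sum>k\<in>\<Union>C \<rightarrow>\<^sub>E {0..<int d}. \<Prod>c\<in>C. w ((\<Sum>a\<in>c. k a) mod int d)) =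
    of_nat d ^ card (\<Union>C) * ((\<Sum>r\<in>{0..<int d}. w r) / of_nat d) ^ card C"
  using assms(1-3)
proof induction
  case empty
  then show ?case by simp
next
  case (insert c C)
  have disj: "c \<inter> c' = {}" if "c' \<in> C" for c'
    using insert.prems(1) insert.hyps(2) that by (intro disjointD[of "insert c C"]) auto
  then have disj': "c \<inter> \<Union>C = {}" by blast
  have "(\<Sum>k\<in>\<Union>(insert c C) \<rightarrow>\<^sub>E {0..<int d}. \<Prod>c\<in>insert c C. w ((\<Sum>a\<in>c. k a) mod int d)) =
      (\<Sum>g\<in>c \<rightarrow>\<^sub>E {0..<int d}. \<Sum>h\<in>\<Union>C \<rightarrow>\<^sub>E {0..<int d}.
        w ((\<Sum>a\<in>c. g a) mod int d) * (\<Prod>c\<in>C. w ((\<Sum>a\<in>c. h a) mod int d)))"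
  proof -
    have "(\<Prod>c'\<in>insert c C. w ((\<Sum>a\<in>c'. if a \<in> c then g a else h a) mod int d)) =
        w ((\<Sum>a\<in>c. g a) mod int d) * (\<Prod>c\<in>C. w ((\<Sum>a\<in>c. h a) mod int d))"
      for g h :: "'b \<Rightarrow> int"
    proof -
      have "(\<Sum>a\<in>c'. if a \<in> c then g a else h a) = (\<Sum>a\<in>c'. h a)" if "c' \<in> C" for c'
        using disj[OF that] by (intro sum.cong) auto
      then show ?thesis
        using insert.hyps by simp
    qed
    then show ?thesis
      by (simp only: Union_insert sum_PiE_Un_disjoint[OF disj'])
  qed
  also have "\<dots> = (\<Sum>g\<in>c \<rightarrow>\<^sub>E {0..<int d}. w ((\<Sum>a\<in>c. g a) mod int d)) *
      (\<Sum>h\<in>\<Union>C \<rightarrow>\<^sub>E {0..<int d}. \<Prod>c\<in>C. w ((\<Sum>a\<in>c. h a) mod int d))"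
    by (simp only: sum_product)
  also have "\<dots> = of_nat d ^ (card c + card (\<Union>C)) * ((\<Sum>r\<in>{0..<int d}. w r) / of_nat d) ^ Suc (card C)"
    using insert.prems assms(4)
    by (subst sum_colourings_block) (simp_all add: insert.IH pairwise_insert power_add)
  also have "card c + card (\<Union>C) = card (\<Union>(insert c C))"
    using disj' insert.prems insert.hyps by (simp add: card_Un_disjoint)
  finally show ?case using insert.hyps by simp
qed

text \<open>Orbits of a permutation with a common point coincide. \<open>orbit p x\<close> starts at
  \<open>p x\<close>; it also contains \<open>x\<close> because \<open>p\<close> permutes a finite
  set.\<close>

lemma orbits_partition:
  assumes "p permutes S" "finite S"
  shows "disjoint (orbit p ` S)" and "\<Union>(orbit p ` S) = S"
proof -
  have perm: "permutation p" using assms by (auto simp: permutation_permutes)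
  show "disjoint (orbit p ` S)"
  proof (rule disjointI)
    fix A B assume AB: "A \<in> orbit p ` S" "B \<in> orbit p ` S" "A \<noteq> B"
    have "A = B" if "x \<in> A" "x \<in> B" for x
      using AB that cyclic_on_orbit'[OF perm] orbit_cyclic_eq3 by (metis imageE)
    then show "A \<inter> B = {}" using AB by blast
  qed
  show "\<Union>(orbit p ` S) = S"
    using permutes_orbit_subset[OF assms(1)] permutation_self_in_orbit[OF perm] by blast
qed

text \<open>For fixed \<open>p\<close> the orbits partition \<open>{1..n}\<close>, which turns the
  sum over colourings into a power with the number of cycles as exponent; the sum over
  \<open>p\<close> then gives the rising factorial.\<close>

lemma sum_coloured_perms:
  fixes w :: "int \<Rightarrow> 'a :: field_char_0"
  assumes "d \<ge> 1"
  shows "(\<Sum>\<sigma>\<in>carrier (coloured_perm_group d n).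
      \<Prod>c\<in>perm_cycles n (fst \<sigma>). w (cycle_colour d (snd \<sigma>) c)) =
    of_nat d ^ n * pochhammer ((\<Sum>r\<in>{0..<int d}. w r) / of_nat d) n"
proof -
  let ?z = "(\<Sum>r\<in>{0..<int d}. w r) / of_nat d"
  have "(\<Sum>\<sigma>\<in>carrier (coloured_perm_group d n).
      \<Prod>c\<in>perm_cycles n (fst \<sigma>). w (cycle_colour d (snd \<sigma>) c)) =
    (\<Sum>p | p permutes {1..n}. \<Sum>k\<in>{1..n} \<rightarrow>\<^sub>E {0..<int d}.
      \<Prod>c\<in>orbit p ` {1..n}. w ((\<Sum>a\<in>c. k a) mod int d))"
    using assms
    by (simp add: coloured_perm_group_def sym_group_def carrier_integer_mod_group
        sum.cartesian_product perm_cycles_def cycle_colour_def case_prod_unfold)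
  also have "\<dots> = (\<Sum>p | p permutes {1..n}. of_nat d ^ n * ?z ^ card (orbit p ` {1..n}))"
  proof (rule sum.cong)
    fix p assume "p \<in> {p. p permutes {1..n}}"
    then have p: "p permutes {1..n}" by simp
    have "finite c \<and> c \<noteq> {}" if "c \<in> orbit p ` {1..n}" for c
      using that permutes_orbit_subset[OF p] orbit_nonempty[of p]
      by (metis finite_atLeastAtMost finite_subset imageE)
    then show "(\<Sum>k\<in>{1..n} \<rightarrow>\<^sub>E {0..<int d}. \<Prod>c\<in>orbit p ` {1..n}. w ((\<Sum>a\<in>c. k a) mod int d)) =
        of_nat d ^ n * ?z ^ card (orbit p ` {1..n})"
      using sum_colourings_blocks[of "orbit p ` {1..n}" d w] orbits_partition[OF p] assms by simp
  qed simp
  also have "\<dots> = of_nat d ^ n * pochhammer ?z n"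
    by (simp add: sum_distrib_left[symmetric] sum_power_card_orbits)
  finally show ?thesis .
qed

lemma carrier_coloured_perm_group:
  assumes "d \<ge> 1"
  shows "finite (carrier (coloured_perm_group d n))"
    and "card (carrier (coloured_perm_group d n)) = fact n * d ^ n"
  using assms
  by (simp_all add: coloured_perm_group_def sym_group_def carrier_integer_mod_group
      finite_permutations finite_PiE card_cartesian_product card_permutations card_PiE)

section \<open>From cycle counts to a product over cycles\<close>

lemma inj_on_int_mod: "inj_on (\<lambda>j. int j mod int d) {1..d}"
proof (rule inj_onI)
  fix i j assume "i \<in> {1..d}" "j \<in> {1..d}" "int i mod int d = int j mod int d"
  then show "i = j"
    \<comment> \<open>Labels below \<open>d\<close> are their own residues, while the label
      \<open>d\<close> has residue 0.\<close>
    by (cases "i = d"; cases "j = d") (auto simp flip: of_nat_mod)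
qed

lemma image_int_mod:
  assumes "d \<ge> 1"
  shows "(\<lambda>j. int j mod int d) ` {1..d} = {0..<int d}"
proof (rule card_subset_eq)
  show "card ((\<lambda>j. int j mod int d) ` {1..d}) = card {0..<int d}"
    using inj_on_int_mod by (simp add: card_image)
qed (use assms in auto)

text \<open>Exactly one label \<open>j\<close> matches a given residue in
  \<open>{0..<int d}\<close>, so the value there is \<open>iexp (\<xi> j)\<close>. The product form
  allows the products over labels and over cycles to be interchanged.\<close>

definition colour_weight :: "nat \<Rightarrow> (nat \<Rightarrow> real) \<Rightarrow> int \<Rightarrow> complex" where
  "colour_weight d \<xi> r = (\<Prod>j=1..d. if r = int j mod int d then iexp (\<xi> j) else 1)"

lemma iexp_pairing_cycle_counts:
  "iexp (pairing d \<xi> (cycle_counts d n \<sigma>)) =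
    (\<Prod>c\<in>perm_cycles n (fst \<sigma>). colour_weight d \<xi> (cycle_colour d (snd \<sigma>) c))"
proof -
  have fin: "finite (perm_cycles n (fst \<sigma>))" by (simp add: perm_cycles_def)
  have "iexp (pairing d \<xi> (cycle_counts d n \<sigma>)) =
      (\<Prod>j=1..d. iexp (\<xi> j) ^ card {c \<in> perm_cycles n (fst \<sigma>). cycle_colour d (snd \<sigma>) c = int j mod int d})"
    by (simp add: pairing_def cycle_counts_def sum_distrib_left exp_sum mult_ac flip: exp_of_nat_mult)
  \<comment> \<open>The power becomes a product over all cycles, those of another colour
    contributing 1.\<close>
  also have "\<dots> = (\<Prod>j=1..d. \<Prod>c\<in>perm_cycles n (fst \<sigma>).
      if cycle_colour d (snd \<sigma>) c = int j mod int d then iexp (\<xi> j) else 1)"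
    using fin by (simp add: prod.If_cases Int_def)
  also have "\<dots> = (\<Prod>c\<in>perm_cycles n (fst \<sigma>). colour_weight d \<xi> (cycle_colour d (snd \<sigma>) c))"
    unfolding colour_weight_def by (rule prod.swap)
  finally show ?thesis .
qed

lemma sum_colour_weight:
  assumes "d \<ge> 1"
  shows "(\<Sum>r\<in>{0..<int d}. colour_weight d \<xi> r) = (\<Sum>j=1..d. iexp (\<xi> j))"
proof -
  have "colour_weight d \<xi> (int i mod int d) = iexp (\<xi> i)" if "i \<in> {1..d}" for i
  proof -
    have "colour_weight d \<xi> (int i mod int d) = (\<Prod>j=1..d. if i = j then iexp (\<xi> j) else 1)"
      unfolding colour_weight_def
      using that inj_on_eq_iff[OF inj_on_int_mod[of d]] by (intro prod.cong if_cong) auto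
    then show ?thesis using that by simp
  qed
  then show ?thesis
    unfolding image_int_mod[OF assms, symmetric]
    by (subst sum.reindex[OF inj_on_int_mod]) simp
qed

section \<open>The limiting function and convergence modulo the Poisson law\<close>

lemma limiting_factor_Suc: "limiting_factor d \<xi> (Suc m) = gamma_factor m (poisson_exponent d \<xi>)"
  by (simp add: limiting_factor_def gamma_factor_def)

lemma limiting_function_eq: "limiting_function d \<xi> = (\<Prod>m. gamma_factor m (poisson_exponent d \<xi>))"
  by (simp add: limiting_function_def limiting_factor_Suc)

theorem theorem5p13:
  fixes d :: nat
    and M :: "nat \<Rightarrow> 'a measure"
    and \<sigma> :: "nat \<Rightarrow> 'a \<Rightarrow> (nat \<Rightarrow> nat) \<times> (nat \<Rightarrow> int)"
  assumes "d \<ge> 1"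
    and "\<And>n. n \<ge> 1 \<Longrightarrow> prob_space (M n)"
    and "\<And>n. n \<ge> 1 \<Longrightarrow> \<sigma> n \<in> measurable (M n) (count_space (carrier (coloured_perm_group d n)))"
    and "\<And>n. n \<ge> 1 \<Longrightarrow>
           distr (M n) (count_space (carrier (coloured_perm_group d n))) (\<sigma> n) =
           uniform_count_measure (carrier (coloured_perm_group d n))"
  shows "converges_mod d M (\<lambda>n \<omega>. cycle_counts d n (\<sigma> n \<omega>))
           (poisson_vec_pmf d) (poisson_exponent d) harm (limiting_function d) \<and>
         (\<forall>\<xi>\<in>real_vecs d.
            convergent_prod (\<lambda>m. limiting_factor d \<xi> (Suc m)) \<and>
            limiting_function d \<xi> =
              exp (- euler_mascheroni * poisson_exponent d \<xi>) *
              rGamma ((1 / of_nat d) * (\<Sum>i=1..d. iexp (\<xi> i))))"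
proof
  \<comment> \<open>The partial product of \<open>n\<close> factors; the index \<open>m\<close>
    stands for the factor with denominator \<open>m + 1\<close>.\<close>
  define \<psi> where "\<psi> n \<xi> = (\<Prod>m<n. gamma_factor m (poisson_exponent d \<xi>))" for n \<xi>
  have "char_fn d (M n) (\<lambda>\<omega>. cycle_counts d n (\<sigma> n \<omega>)) \<xi> =
      exp (of_real (harm n) * poisson_exponent d \<xi>) * \<psi> n \<xi>" if "n \<ge> 1" for n \<xi>
  proof -
    let ?G = "carrier (coloured_perm_group d n)"
    \<comment> \<open>Change of variables: the law of \<open>\<sigma> n\<close> is uniform on the
      group, so the expectation is an average over its elements.\<close>
    have "char_fn d (M n) (\<lambda>\<omega>. cycle_counts d n (\<sigma> n \<omega>)) \<xi> =
        (LINT s|uniform_count_measure ?G. iexp (pairing d \<xi> (cycle_counts d n s)))"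
      unfolding char_fn_def assms(4)[OF that, symmetric]
      by (subst integral_distr[OF assms(3)[OF that]]) simp_all
    also have "\<dots> = (\<Sum>s\<in>?G. iexp (pairing d \<xi> (cycle_counts d n s))) / of_nat (card ?G)"
      using carrier_coloured_perm_group(1)[OF assms(1)]
      by (simp add: uniform_count_measure_def lebesgue_integral_point_measure_finite
          scaleR_conv_of_real sum_divide_distrib)
    \<comment> \<open>The factor \<open>d ^ n\<close> from the colourings cancels against the group
      order \<open>fact n * d ^ n\<close>.\<close>
    also have "\<dots> = pochhammer (1 + poisson_exponent d \<xi>) n / fact n"
      unfolding iexp_pairing_cycle_counts sum_coloured_perms[OF assms(1)] sum_colour_weight[OF assms(1)]
        carrier_coloured_perm_group(2)[OF assms(1)] poisson_exponent_plus_1[OF assms(1)]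
      using assms(1) by simp
    finally show ?thesis
      unfolding \<psi>_def pochhammer_eq_harm_gamma_factor .
  qed
  moreover have "uniform_limit (real_vecs d) \<psi> (limiting_function d) sequentially"
    unfolding \<psi>_def limiting_function_eq
    \<comment> \<open>The radius 2 is the bound of \<open>norm_poisson_exponent_le\<close>.\<close>
    by (rule uniform_limit_compose'[OF uniform_limit_gamma_factor[of 2]])
      (use norm_poisson_exponent_le[OF assms(1)] in auto)
  moreover have "has_exponent d (poisson_vec_pmf d) (poisson_exponent d)"
    using char_fn_poisson_vec_pmf[OF assms(1)] continuous_on_poisson_exponent
    by (simp add: has_exponent_def poisson_exponent_def)
  ultimately show "converges_mod d M (\<lambda>n \<omega>. cycle_counts d n (\<sigma> n \<omega>))
      (poisson_vec_pmf d) (poisson_exponent d) harm (limiting_function d)"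
    unfolding converges_mod_def using harm_at_top by blast
  show "\<forall>\<xi>\<in>real_vecs d. convergent_prod (\<lambda>m. limiting_factor d \<xi> (Suc m)) \<and>
      limiting_function d \<xi> = exp (- euler_mascheroni * poisson_exponent d \<xi>) *
        rGamma ((1 / of_nat d) * (\<Sum>i=1..d. iexp (\<xi> i)))"
    unfolding limiting_factor_Suc limiting_function_eq prodinf_gamma_factor
      poisson_exponent_plus_1[OF assms(1)]
    using convergent_prod_gamma_factor by simp
qed

end
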